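(* Let $\alpha\in\mathbb{R}\setminus\mathbb{Q}$. Then $(\mathbb{Z};+,C_\alpha)$ is tmc-minimal; that is, every subset of $\mathbb{Z}$ definable in $(\mathbb{Z};+,C_\alpha)$ is a finite union of tmc-sets, where convexity is taken with respect to $C_\alpha$.
   Context: Let $C$ be the ternary relation on $\mathbb{R}/\mathbb{Z}$ (the positively oriented circle) such that for $a,b,c\in[0,1)$, $C(a+\mathbb{Z},b+\mathbb{Z},c+\mathbb{Z})$ holds iff $a<b<c$ or $b<c<a$ or $c<a<b$. For $\alpha\in\mathbb{R}\setminus\mathbb{Q}$, $C_\alpha$ is the ternary relation (an additive cyclic order) on $\mathbb{Z}$ given by: $C_\alpha(j,k,l)$ iff $C(\alpha j+\mathbb{Z},\alpha k+\mathbb{Z},\alpha l+\mathbb{Z})$. A subset $J\subseteq\mathbb{Z}$ is convex with respect to $C_\alpha$ if whenever $a,b\in J$ are distinct, either $\{t: C_\alpha(a,t,b)\}\subseteq J$ or $\{t: C_\alpha(b,t,a)\}\subseteq J$. A tmc-set is a translate of a multiple of a convex set, i.e. a set of the form $a+mJ=\{a+mg: g\in J\}$ with $a\in\mathbb{Z}$, $m\in\mathbb{N}=\{0,1,2,\dots\}$ and $J\subseteq\mathbb{Z}$ convex. "Definable" means first-order definable, parameters allowed. *)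

theory Defs
  imports Complex_Main
begin

definition coset :: "real \<Rightarrow> real set" where
  "coset x = {x + of_int n | n. True}"

(* The ternary relation C on R/Z, whose elements are the cosets x + Z. *)
definition circle_order :: "real set \<Rightarrow> real set \<Rightarrow> real set \<Rightarrow> bool" where
  "circle_order X Y Z \<longleftrightarrow>
     (\<exists>a\<in>{0..<1}. \<exists>b\<in>{0..<1}. \<exists>c\<in>{0..<1}.
        X = coset a \<and> Y = coset b \<and> Z = coset c \<and>
        (a < b \<and> b < c \<or> b < c \<and> c < a \<or> c < a \<and> a < b))"

definition cyc :: "real \<Rightarrow> int \<Rightarrow> int \<Rightarrow> int \<Rightarrow> bool" where
  "cyc \<alpha> j k l \<longleftrightarrow>
     circle_order (coset (\<alpha> * of_int j)) (coset (\<alpha> * of_int k)) (coset (\<alpha> * of_int l))"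

definition cyc_convex :: "(int \<Rightarrow> int \<Rightarrow> int \<Rightarrow> bool) \<Rightarrow> int set \<Rightarrow> bool" where
  "cyc_convex R J \<longleftrightarrow>
     (\<forall>a\<in>J. \<forall>b\<in>J. a \<noteq> b \<longrightarrow> {t. R a t b} \<subseteq> J \<or> {t. R b t a} \<subseteq> J)"

definition tmc_set :: "(int \<Rightarrow> int \<Rightarrow> int \<Rightarrow> bool) \<Rightarrow> int set \<Rightarrow> bool" where
  "tmc_set R T \<longleftrightarrow>
     (\<exists>(a::int) (m::nat) J. cyc_convex R J \<and> T = {a + int m * g | g. g \<in> J})"

(* First-order syntax and semantics for the language with one binary function symbol
   and one ternary relation symbol, interpreted in the structure (Z; +, R). *)

datatype tm = Var nat | Plus tm tm

datatype fm = Eq tm tm | Rel tm tm tm | Neg fm | Conj fm fm | Ex nat fm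

primrec tm_val :: "(nat \<Rightarrow> int) \<Rightarrow> tm \<Rightarrow> int" where
  "tm_val e (Var n) = e n"
| "tm_val e (Plus s t) = tm_val e s + tm_val e t"

primrec sat :: "(int \<Rightarrow> int \<Rightarrow> int \<Rightarrow> bool) \<Rightarrow> (nat \<Rightarrow> int) \<Rightarrow> fm \<Rightarrow> bool" where
  "sat R e (Eq s t) \<longleftrightarrow> tm_val e s = tm_val e t"
| "sat R e (Rel s t u) \<longleftrightarrow> R (tm_val e s) (tm_val e t) (tm_val e u)"
| "sat R e (Neg p) \<longleftrightarrow> \<not> sat R e p"
| "sat R e (Conj p q) \<longleftrightarrow> sat R e p \<and> sat R e q"
| "sat R e (Ex n p) \<longleftrightarrow> (\<exists>x. sat R (e(n := x)) p)"

(* Definability with parameters: variable 0 ranges over the set being defined, and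
   the assignment e supplies the parameters as values of the other free variables. *)
definition definable :: "(int \<Rightarrow> int \<Rightarrow> int \<Rightarrow> bool) \<Rightarrow> int set \<Rightarrow> bool" where
  "definable R S \<longleftrightarrow> (\<exists>p e. S = {x. sat R (e(0 := x)) p})"

definition tmc_minimal :: "(int \<Rightarrow> int \<Rightarrow> int \<Rightarrow> bool) \<Rightarrow> bool" where
  "tmc_minimal R \<longleftrightarrow>
     (\<forall>S. definable R S \<longrightarrow> (\<exists>F. finite F \<and> (\<forall>T\<in>F. tmc_set R T) \<and> S = \<Union>F))"

end

theory Submission
  imports Defs "HOL-Analysis.Kronecker_Approximation_Theorem" "HOL-Library.FuncSet"
begin

text \<open>
  Write $H = \mathbb{Z} + \alpha\mathbb{Z} \subseteq \mathbb{R}$, a dense subgroup. An integer $x$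
  is identified with the representative \<open>frac (\<alpha> * x)\<close> in $[0,1)$ of the point
  $\alpha x + \mathbb{Z}$ of the circle; since $\alpha$ is irrational, this is a bijection between
  the integers and $H \cap [0,1)$. In these coordinates the cyclic order becomes the order of the
  reals, and addition becomes addition in $H$ up to an integer carry. So the structure is
  interpreted in the ordered group $H$ with the constant 1, whose elements are compared by signs of
  integer linear combinations and by congruence modulo multiples $MH$.

  The proof is an Ehrenfeucht--Fraisse argument on such data. Two tuples of reals are called similar at level $(N, M)$ (\<open>sim\<close>) if all
  integer linear combinations with coefficients of size at most $N$ have the same sign at both
  tuples, and corresponding entries differ by elements of $MH$. Two facts carry the proof.

  \<^item> Back and forth (\<open>back_and_forth\<close>): if two tuples are similar at a sufficiently fine level and one
    coordinate of the first is changed, the same coordinate of the second can be changed so that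
    the results are similar at level $(N, M)$. Up to scaling, the signs involving the new entry
    say where it lies in a finite set of reals, and density of $MH$ allows the corresponding cut
    of the second tuple to be met within the prescribed congruence class.
    Hence, by induction on formulas, the truth of a formula depends only on the similarity class of
    the tuple at some level (\<open>sat_invariant\<close>).

  \<^item> When only one entry $x$ varies, there are finitely many similarity classes
    (\<open>finite_sim_classes\<close>), and each is given by an interval of values of \<open>frac (\<alpha> * x)\<close> together with
    a congruence modulo $MH$. Such a set is $x + MJ$ for a convex set $J$ (\<open>tmc_set_sim_class\<close>),
    because dividing by $M$ turns the interval into an arc of length at most $1/M$.

  A definable set is therefore the union of the finitely many classes that it meets.
\<close>

section \<open>The cyclic order in terms of fractional parts\<close>

lemma coset_eq_iff: "coset x = coset y \<longleftrightarrow> x - y \<in> \<int>"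
proof
  assume "coset x = coset y"
  moreover have "x \<in> coset x" by (force simp: coset_def intro: exI [of _ 0])
  ultimately obtain n :: int where "x = y + of_int n" by (auto simp: coset_def)
  then show "x - y \<in> \<int>" by simp
next
  assume "x - y \<in> \<int>"
  then obtain n :: int where n: "x = y + of_int n"
    by (metis Ints_cases add.commute diff_eq_eq)
  show "coset x = coset y"
  proof (intro set_eqI iffI)
    fix z assume "z \<in> coset x"
    then obtain k :: int where "z = y + of_int (n + k)" by (auto simp: coset_def n)
    then show "z \<in> coset y" unfolding coset_def by blast
  next
    fix z assume "z \<in> coset y"
    then obtain k :: int where "z = x + of_int (k - n)" by (auto simp: coset_def n)
    then show "z \<in> coset x" unfolding coset_def by blast
  qed
qed

lemma coset_eq_coset_iff_frac:
  assumes "a \<in> {0..<1}"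
  shows "coset x = coset a \<longleftrightarrow> frac x = a"
  using assms by (simp add: coset_eq_iff frac_unique_iff)

lemma cyc_iff_frac:
  "cyc \<alpha> j k l \<longleftrightarrow>
     (let a = frac (\<alpha> * of_int j); b = frac (\<alpha> * of_int k); c = frac (\<alpha> * of_int l)
      in a < b \<and> b < c \<or> b < c \<and> c < a \<or> c < a \<and> a < b)"
proof -
  have "frac (\<alpha> * of_int i) \<in> {0..<1}" for i by (simp add: frac_lt_1)
  then show ?thesis
    unfolding cyc_def circle_order_def Let_def
    by (auto simp: coset_eq_coset_iff_frac Bex_def)
qed

lemma irrational_mult_int_diff:
  fixes \<alpha> :: real
  assumes "\<alpha> \<notin> \<rat>" "\<alpha> * of_int x - \<alpha> * of_int y \<in> \<int>"
  shows "x = y"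
proof (rule ccontr)
  assume "x \<noteq> y"
  obtain n :: int where "\<alpha> * of_int x - \<alpha> * of_int y = of_int n" using assms(2) Ints_cases by blast
  then have "\<alpha> * of_int (x - y) = of_int n" by (simp add: right_diff_distrib)
  then have "\<alpha> = of_int n / of_int (x - y)"
    using \<open>x \<noteq> y\<close> by (metis eq_iff_diff_eq_0 nonzero_eq_divide_eq of_int_eq_0_iff)
  then show False using assms(1) by simp
qed

lemma frac_inject_irrational:
  fixes \<alpha> :: real
  assumes "\<alpha> \<notin> \<rat>"
  shows "frac (\<alpha> * of_int x) = frac (\<alpha> * of_int y) \<longleftrightarrow> x = y"
proof
  assume eq: "frac (\<alpha> * of_int x) = frac (\<alpha> * of_int y)"
  have "\<alpha> * of_int x - \<alpha> * of_int y = of_int (\<lfloor>\<alpha> * of_int x\<rfloor> - \<lfloor>\<alpha> * of_int y\<rfloor>)"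
    using eq by (simp add: frac_def)
  then have "\<alpha> * of_int x - \<alpha> * of_int y \<in> \<int>" by (metis Ints_of_int)
  then show "x = y" using assms irrational_mult_int_diff by blast
qed simp

section \<open>Similarity of real tuples and back and forth\<close>

definition int_span :: "real \<Rightarrow> real set" where
  "int_span \<alpha> = {\<alpha> * of_int j + of_int k | j k. True}"

lemma int_span_add: "x \<in> int_span \<alpha> \<Longrightarrow> y \<in> int_span \<alpha> \<Longrightarrow> x + y \<in> int_span \<alpha>"
proof -
  assume "x \<in> int_span \<alpha>" "y \<in> int_span \<alpha>"
  then obtain j k j' k' where "x = \<alpha> * of_int j + of_int k" "y = \<alpha> * of_int j' + of_int k'"
    unfolding int_span_def by blast
  then have "x + y = \<alpha> * of_int (j + j') + of_int (k + k')" by (simp add: algebra_simps)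
  then show ?thesis unfolding int_span_def by blast
qed

lemma int_span_int_mult: "x \<in> int_span \<alpha> \<Longrightarrow> of_int m * x \<in> int_span \<alpha>"
proof -
  assume "x \<in> int_span \<alpha>"
  then obtain j k where "x = \<alpha> * of_int j + of_int k" unfolding int_span_def by blast
  then have "of_int m * x = \<alpha> * of_int (m * j) + of_int (m * k)" by (simp add: algebra_simps)
  then show ?thesis unfolding int_span_def by blast
qed

lemma int_span_0: "0 \<in> int_span \<alpha>"
  unfolding int_span_def by (auto intro!: exI [of _ 0])

lemma int_span_int_combination:
  "finite V \<Longrightarrow> (\<And>i. i \<in> V \<Longrightarrow> h i \<in> int_span \<alpha>) \<Longrightarrow> (\<Sum>i\<in>V. of_int (c i) * h i) \<in> int_span \<alpha>"
  by (induction V rule: finite_induct) (simp_all add: int_span_0 int_span_add int_span_int_mult)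

lemma int_span_dense:
  assumes "\<alpha> \<notin> \<rat>" "a < b"
  shows "\<exists>h\<in>int_span \<alpha>. a < h \<and> h < b"
proof -
  have "(b - a) / 2 > 0" using assms by simp
  then obtain p k where "\<bar>of_int k * \<alpha> - of_int p - (a + b) / 2\<bar> < (b - a) / 2"
    using sequence_of_fractional_parts_is_dense [OF assms(1)] by metis
  then have "a < \<alpha> * of_int k + of_int (- p)" "\<alpha> * of_int k + of_int (- p) < b"
    by (simp_all add: abs_less_iff field_simps)
  then show ?thesis unfolding int_span_def by blast
qed

definition lin :: "'i set \<Rightarrow> ('i \<Rightarrow> int) \<Rightarrow> ('i \<Rightarrow> real) \<Rightarrow> real" where
  "lin V c e = (\<Sum>i\<in>V. of_int (c i) * e i)"

text \<open>
  The tuples themselves are arbitrary reals; only their differences are required to lie in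
  $M(\mathbb{Z} + \alpha\mathbb{Z})$. This suffices for the back-and-forth step, because a new entry
  is only ever shifted by an element of that group.
\<close>

definition sim :: "real \<Rightarrow> 'i set \<Rightarrow> nat \<Rightarrow> nat \<Rightarrow> ('i \<Rightarrow> real) \<Rightarrow> ('i \<Rightarrow> real) \<Rightarrow> bool" where
  "sim \<alpha> V N M e e' \<longleftrightarrow>
     (\<forall>c. (\<forall>i\<in>V. \<bar>c i\<bar> \<le> int N) \<longrightarrow> sgn (lin V c e) = sgn (lin V c e')) \<and>
     (\<forall>i\<in>V. \<exists>h\<in>int_span \<alpha>. e' i = e i + of_nat M * h)"

lemma sim_sgn:
  "sim \<alpha> V N M e e' \<Longrightarrow> (\<And>i. i \<in> V \<Longrightarrow> \<bar>c i\<bar> \<le> int N) \<Longrightarrow> sgn (lin V c e) = sgn (lin V c e')"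
  unfolding sim_def by blast

lemma sim_mono:
  assumes "sim \<alpha> V N' M' e e'" "N \<le> N'" "M dvd M'"
  shows "sim \<alpha> V N M e e'"
  unfolding sim_def
proof (intro conjI allI impI ballI)
  fix c assume "\<forall>i\<in>V. \<bar>c i\<bar> \<le> int N"
  then show "sgn (lin V c e) = sgn (lin V c e')"
    using assms(1,2) by (intro sim_sgn) force+
next
  fix i assume "i \<in> V"
  then obtain h where h: "h \<in> int_span \<alpha>" "e' i = e i + of_nat M' * h"
    using assms(1) unfolding sim_def by blast
  obtain q where "M' = M * q" using assms(3) by blast
  then have "e' i = e i + of_nat M * (of_int (int q) * h)" using h by simp
  then show "\<exists>h\<in>int_span \<alpha>. e' i = e i + of_nat M * h"
    using int_span_int_mult [OF h(1)] by blast
qed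

lemma lin_update:
  assumes "finite V" "i \<in> V"
  shows "lin V c (e(i := x)) = of_int (c i) * x + lin V (c(i := 0)) e"
proof -
  have "lin V c (e(i := x)) = of_int (c i) * x + (\<Sum>j\<in>V - {i}. of_int (c j) * e j)"
    unfolding lin_def by (simp add: sum.remove [OF assms])
  moreover have "lin V (c(i := 0)) e = (\<Sum>j\<in>V - {i}. of_int (c j) * e j)"
    unfolding lin_def by (simp add: sum.remove [OF assms])
  ultimately show ?thesis by simp
qed

lemma lin_scale: "lin V (\<lambda>j. k * c j) e = of_int k * lin V c e"
  unfolding lin_def by (simp add: sum_distrib_left mult.assoc)

lemma lin_diff: "lin V (\<lambda>j. c j - d j) e = lin V c e - lin V d e"
  unfolding lin_def by (simp add: sum_subtractf algebra_simps)

lemma lin_cong: "(\<And>i. i \<in> V \<Longrightarrow> c i = d i) \<Longrightarrow> lin V c e = lin V d e"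
  unfolding lin_def by (rule sum.cong) auto

lemma separating_interval:
  fixes A B :: "real set"
  assumes "finite A" "finite B" "\<And>a b. a \<in> A \<Longrightarrow> b \<in> B \<Longrightarrow> a < b"
  shows "\<exists>l r. l < r \<and> (\<forall>a\<in>A. a \<le> l) \<and> (\<forall>b\<in>B. r \<le> b)"
proof (cases "A = {}")
  case True
  then have "\<forall>a\<in>A. a \<le> Min B - 1" "\<forall>b\<in>B. Min B \<le> b" using assms by auto
  then show ?thesis by (intro exI [of _ "Min B - 1"] exI [of _ "Min B"]) simp
next
  case A: False
  show ?thesis
  proof (cases "B = {}")
    case True
    then show ?thesis using assms A by (intro exI [of _ "Max A"] exI [of _ "Max A + 1"]) simp
  next
    case False
    then show ?thesis using assms A by (intro exI [of _ "Max A"] exI [of _ "Min B"]) simp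
  qed
qed

text \<open>
  The pairs in \<open>P\<close> form the graph of an order isomorphism between two finite sets of reals, and a
  point \<open>z\<close> in a gap of the first set has a corresponding open gap \<open>(l, r)\<close> in the second. The
  interval may be taken bounded on both sides even at the ends.
\<close>

lemma transfer_cut:
  fixes P :: "(real \<times> real) set"
  assumes "finite P"
    and mono: "\<And>p q p' q'. (p, q) \<in> P \<Longrightarrow> (p', q') \<in> P \<Longrightarrow> sgn (p - p') = sgn (q - q')"
    and z: "\<And>p q. (p, q) \<in> P \<Longrightarrow> p \<noteq> z"
  shows "\<exists>l r. l < r \<and> (\<forall>t. l < t \<and> t < r \<longrightarrow> (\<forall>(p, q)\<in>P. sgn (z - p) = sgn (t - q)))"
proof -
  define A where "A = snd ` {(p, q) \<in> P. p < z}"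
  define B where "B = snd ` {(p, q) \<in> P. z < p}"
  have "finite A" "finite B"
    unfolding A_def B_def using assms(1) by (auto intro: finite_subset [of _ P])
  moreover have "a < b" if ab: "a \<in> A" "b \<in> B" for a b
  proof -
    obtain p p' where "(p, a) \<in> P" "p < z" "(p', b) \<in> P" "z < p'"
      using ab unfolding A_def B_def by auto
    then have "sgn (a - b) = sgn (p - p')" "p < p'" using mono by force+
    then show "a < b" by (auto simp: sgn_if split: if_splits)
  qed
  ultimately obtain l r where lr: "l < r" "\<forall>a\<in>A. a \<le> l" "\<forall>b\<in>B. r \<le> b"
    using separating_interval [of A B] by metis
  have "sgn (z - p) = sgn (t - q)" if "l < t" "t < r" "(p, q) \<in> P" for t p q
  proof (cases "p < z")
    case True
    then have "q \<in> A" using that unfolding A_def by force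
    then have "q < t" using lr that by force
    then show ?thesis using True by simp
  next
    case False
    then have "z < p" using z that by force
    then have "q \<in> B" using that unfolding B_def by force
    then have "t < q" using lr that by force
    then show ?thesis using \<open>z < p\<close> by simp
  qed
  then show ?thesis using lr(1) by blast
qed

text \<open>
  Infinitely many \<open>w\<close> satisfy the bound, since they are free outside \<open>V\<close>, but the value depends only
  on the restriction to \<open>V\<close>.
\<close>

lemma finite_lin_values:
  assumes "finite V"
  shows "finite {(lin V w e, lin V w e') | w. \<forall>j\<in>V. \<bar>w j\<bar> \<le> int K}" (is "finite ?P")
proof -
  have "?P \<subseteq> (\<lambda>w. (lin V w e, lin V w e')) ` (V \<rightarrow>\<^sub>E {- int K..int K})"
  proof
    fix pq assume "pq \<in> ?P"
    then obtain w where w: "pq = (lin V w e, lin V w e')" "\<forall>j\<in>V. \<bar>w j\<bar> \<le> int K" by blast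
    have "pq = (lin V (restrict w V) e, lin V (restrict w V) e')"
      unfolding w(1) by (simp cong: lin_cong add: lin_def)
    moreover have "restrict w V \<in> V \<rightarrow>\<^sub>E {- int K..int K}" using w(2) by (auto simp: abs_le_iff)
    ultimately show "pq \<in> (\<lambda>w. (lin V w e, lin V w e')) ` (V \<rightarrow>\<^sub>E {- int K..int K})" by blast
  qed
  moreover have "finite (V \<rightarrow>\<^sub>E {- int K..int K})" using assms by (intro finite_PiE) auto
  ultimately show ?thesis by (meson finite_imageI finite_subset)
qed

text \<open>
  A combination that involves the new entry \<open>x\<close> with a coefficient \<open>c i \<noteq> 0\<close> can be scaled by the
  positive integer \<open>L / \<bar>c i\<bar>\<close> with \<open>L = fact N\<close>, a multiple of all such coefficients. Its sign then
  compares \<open>L * x\<close> with the value at \<open>e\<close> of a combination \<open>w\<close> that omits \<open>i\<close> and has coefficients of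
  size at most \<open>L * N\<close>. Differences of two such \<open>w\<close> have coefficients of size at most
  \<open>2 * L * N\<close>, so the hypothesis says that \<open>e\<close> and \<open>e'\<close> order these values in the same way. If \<open>L * x\<close> is
  one of the values, the new entry of \<open>e'\<close> is forced, and the congruence modulo \<open>L * M\<close> in the
  hypothesis is what makes it congruent to \<open>x\<close> modulo \<open>M\<close>; otherwise there is an open interval of
  choices and density applies.
\<close>

lemma back_and_forth:
  fixes e e' :: "'i \<Rightarrow> real" and x :: real
  assumes irr: "\<alpha> \<notin> \<rat>" and V: "finite V" "i \<in> V" and M: "M > 0"
    and sim: "sim \<alpha> V (2 * (fact N * N)) (fact N * M) e e'"
  shows "\<exists>h\<in>int_span \<alpha>. sim \<alpha> V N M (e(i := x)) (e'(i := x + of_nat M * h))"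
proof -
  define L :: nat where "L = fact N"
  \<comment> \<open>The combinations of the unchanged entries with whose values \<open>L * x\<close> has to be compared.\<close>
  define U where "U = {w. (\<forall>j\<in>V. \<bar>w j\<bar> \<le> int (L * N)) \<and> w i = (0::int)}"
  have L: "L > 0" by (simp add: L_def)
  have "1 * N \<le> 2 * fact N * N" using L unfolding L_def [symmetric] by (intro mult_right_mono) auto
  then have coarser: "sim \<alpha> V N M e e'" by (intro sim_mono [OF sim]) (simp_all add: mult.assoc)
  have UU: "sgn (lin V w e - lin V w' e) = sgn (lin V w e' - lin V w' e')"
    if "w \<in> U" "w' \<in> U" for w w'
  proof -
    have "\<bar>w j - w' j\<bar> \<le> int (2 * (fact N * N))" if j: "j \<in> V" for j
    proof -
      have "\<bar>w j\<bar> \<le> int (L * N)" "\<bar>w' j\<bar> \<le> int (L * N)"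
        using \<open>w \<in> U\<close> \<open>w' \<in> U\<close> j unfolding U_def by blast+
      moreover have "int (2 * (fact N * N)) = int (L * N) + int (L * N)" by (simp add: L_def)
      ultimately show ?thesis by linarith
    qed
    then show ?thesis using sim_sgn [OF sim, of "\<lambda>j. w j - w' j"] by (simp add: lin_diff)
  qed
  have "\<exists>h\<in>int_span \<alpha>. \<forall>w\<in>U. sgn (L * x - lin V w e) = sgn (L * (x + M * h) - lin V w e')"
  proof (cases "\<exists>u\<in>U. L * x = lin V u e")
    case True
    then obtain u where u: "u \<in> U" "L * x = lin V u e" by blast
    have "\<exists>g. \<forall>j\<in>V. g j \<in> int_span \<alpha> \<and> e' j = e j + of_nat (L * M) * g j"
      using sim unfolding sim_def L_def by metis
    then obtain g where g: "\<And>j. j \<in> V \<Longrightarrow> g j \<in> int_span \<alpha>"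
      "\<And>j. j \<in> V \<Longrightarrow> e' j = e j + of_nat (L * M) * g j" by blast
    define h where "h = (\<Sum>j\<in>V. of_int (u j) * g j)"
    have "h \<in> int_span \<alpha>" unfolding h_def using V(1) g(1) by (rule int_span_int_combination)
    have "lin V u e' = (\<Sum>j\<in>V. of_int (u j) * e j + of_nat (L * M) * (of_int (u j) * g j))"
      unfolding lin_def by (rule sum.cong) (auto simp: g(2) algebra_simps)
    also have "\<dots> = lin V u e + L * M * h"
      unfolding lin_def h_def by (simp add: sum.distrib sum_distrib_left)
    finally have eq: "L * (x + M * h) = lin V u e'" using u(2) by (simp add: algebra_simps)
    have "\<forall>w\<in>U. sgn (L * x - lin V w e) = sgn (L * (x + M * h) - lin V w e')"
      unfolding eq u(2) using UU u(1) by blast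
    then show ?thesis using \<open>h \<in> int_span \<alpha>\<close> by blast
  next
    case False
    define P where "P = (\<lambda>w. (lin V w e, lin V w e')) ` U"
    have "P \<subseteq> {(lin V w e, lin V w e') | w. \<forall>j\<in>V. \<bar>w j\<bar> \<le> int (L * N)}"
      unfolding P_def U_def by blast
    then have "finite P" using finite_lin_values [OF V(1)] finite_subset by blast
    then obtain l r where lr: "l < r"
      "\<And>t. l < t \<Longrightarrow> t < r \<Longrightarrow> \<forall>(p, q)\<in>P. sgn (L * x - p) = sgn (t - q)"
      using transfer_cut [of P "L * x"] UU False unfolding P_def by fastforce
    \<comment> \<open>Solving \<open>t = L * (x + M * h)\<close> for \<open>h\<close> turns the gap into an interval for \<open>h\<close>.\<close>
    define s where "s = (\<lambda>t. (t / L - x) / M)"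
    have "s l < s r" unfolding s_def using lr(1) L M by (simp add: divide_strict_right_mono)
    then obtain h where h: "h \<in> int_span \<alpha>" "s l < h" "h < s r"
      using int_span_dense [OF irr] by blast
    have "l < L * (x + M * h)" "L * (x + M * h) < r"
      using h(2,3) L M unfolding s_def by (simp_all add: field_simps)
    then show ?thesis using lr(2) h(1) unfolding P_def by auto
  qed
  then obtain h :: real where h: "h \<in> int_span \<alpha>"
    "\<And>w. w \<in> U \<Longrightarrow> sgn (L * x - lin V w e) = sgn (L * (x + M * h) - lin V w e')" by blast
  have "sim \<alpha> V N M (e(i := x)) (e'(i := x + M * h))"
    unfolding sim_def
  proof (intro conjI allI impI ballI)
    fix c assume c: "\<forall>j\<in>V. \<bar>c j\<bar> \<le> int N"
    show "sgn (lin V c (e(i := x))) = sgn (lin V c (e'(i := x + M * h)))"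
    proof (cases "c i = 0")
      case True
      have "sgn (lin V (c(i := 0)) e) = sgn (lin V (c(i := 0)) e')"
        using c by (intro sim_sgn [OF coarser]) simp
      then show ?thesis using True by (simp add: lin_update [OF V])
    next
      case False
      have "1 \<le> nat \<bar>c i\<bar>" "nat \<bar>c i\<bar> \<le> N" using False c V(2) by auto
      then have "nat \<bar>c i\<bar> dvd L" unfolding L_def by (rule dvd_fact)
      then obtain q where q: "L = nat \<bar>c i\<bar> * q" by blast
      then have "q > 0" using L by (cases q) auto
      have "q \<le> L" using q \<open>1 \<le> nat \<bar>c i\<bar>\<close> by simp
      define w where "w = (\<lambda>j. (- sgn (c i) * int q) * (c(i := 0)) j)"
      have "w \<in> U"
        unfolding U_def
      proof (intro CollectI conjI ballI)
        fix j assume "j \<in> V"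
        then have "\<bar>(c(i := 0)) j\<bar> \<le> int N" using c by auto
        then have "int q * \<bar>(c(i := 0)) j\<bar> \<le> int L * int N"
          using \<open>q \<le> L\<close> by (intro mult_mono) auto
        moreover have "\<bar>w j\<bar> = int q * \<bar>(c(i := 0)) j\<bar>"
          using False by (simp add: w_def abs_mult)
        ultimately show "\<bar>w j\<bar> \<le> int (L * N)" by simp
      qed (simp add: w_def)
      have L': "real L = of_int \<bar>c i\<bar> * real q" using q by simp
      have *: "sgn (of_int (c i) * y + lin V (c(i := 0)) f) = of_int (sgn (c i)) * sgn (L * y - lin V w f)"
        for y :: real and f
      proof -
        have "lin V w f = of_int (- sgn (c i) * int q) * lin V (c(i := 0)) f"
          unfolding w_def by (rule lin_scale)
        then have "real q * (of_int (c i) * y + lin V (c(i := 0)) f) =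
              of_int (sgn (c i)) * (L * y - lin V w f)"
          using False by (cases "c i > 0") (simp_all add: L' algebra_simps del: fun_upd_apply)
        then have "sgn (real q * (of_int (c i) * y + lin V (c(i := 0)) f)) =
              sgn (of_int (sgn (c i)) * (L * y - lin V w f))" by simp
        moreover have "sgn (of_int (sgn (c i)) * z) = of_int (sgn (c i)) * sgn z" for z :: real
          using False by (cases "c i > 0") (simp_all add: sgn_minus)
        ultimately show ?thesis using \<open>q > 0\<close> by (simp only: sgn_mult) simp
      qed
      show ?thesis
        unfolding lin_update [OF V] * using h(2) [OF \<open>w \<in> U\<close>] by simp
    qed
  next
    fix j assume j: "j \<in> V"
    show "\<exists>k\<in>int_span \<alpha>. (e'(i := x + M * h)) j = (e(i := x)) j + of_nat M * k"
    proof (cases "j = i")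
      case True
      then show ?thesis using h(1) by auto
    next
      case False
      then show ?thesis using coarser j unfolding sim_def by simp
    qed
  qed
  then show ?thesis using h(1) by blast
qed


section \<open>Truth of a formula depends only on a similarity class\<close>

lemma sim_sym: "sim \<alpha> V N M e e' \<Longrightarrow> sim \<alpha> V N M e' e"
  unfolding sim_def
proof (elim conjE, intro conjI ballI)
  fix i assume "\<forall>i\<in>V. \<exists>h\<in>int_span \<alpha>. e' i = e i + real M * h" "i \<in> V"
  then obtain h where h: "h \<in> int_span \<alpha>" "e' i = e i + real M * h" by blast
  have "of_int (- 1) * h \<in> int_span \<alpha>" using h(1) by (rule int_span_int_mult)
  then show "\<exists>h\<in>int_span \<alpha>. e i = e' i + real M * h"
    using h(2) by (intro bexI [of _ "- h"]) auto
qed simp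

lemma sim_trans:
  assumes "sim \<alpha> V N M e e'" "sim \<alpha> V N M e' e''"
  shows "sim \<alpha> V N M e e''"
  unfolding sim_def
proof (intro conjI ballI allI impI)
  fix c assume "\<forall>i\<in>V. \<bar>c i\<bar> \<le> int N"
  then show "sgn (lin V c e) = sgn (lin V c e'')"
    using assms unfolding sim_def by simp
next
  fix i assume "i \<in> V"
  then obtain h h' where h: "h \<in> int_span \<alpha>" "h' \<in> int_span \<alpha>"
    "e' i = e i + real M * h" "e'' i = e' i + real M * h'"
    using assms unfolding sim_def by blast
  then have "e'' i = e i + real M * (h + h')" by (simp add: algebra_simps)
  then show "\<exists>h\<in>int_span \<alpha>. e'' i = e i + real M * h" using h(1,2) int_span_add by blast
qed

text \<open>
  The additional coordinate \<open>n\<close> holds the constant 1, so that homogeneous combinations over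
  \<open>{..n}\<close> express all affine combinations of the circle coordinates of the variables below \<open>n\<close>.
\<close>

definition circle_env :: "real \<Rightarrow> nat \<Rightarrow> (nat \<Rightarrow> int) \<Rightarrow> nat \<Rightarrow> real" where
  "circle_env \<alpha> n e i = (if i < n then frac (\<alpha> * of_int (e i)) else 1)"

lemma circle_env_update: "i < n \<Longrightarrow> circle_env \<alpha> n (e(i := x)) = (circle_env \<alpha> n e)(i := frac (\<alpha> * of_int x))"
  by (auto simp: circle_env_def fun_eq_iff)

lemma lin_circle_env:
  "lin {..n} c (circle_env \<alpha> n e) = (\<Sum>i<n. of_int (c i) * frac (\<alpha> * of_int (e i))) + of_int (c n)"
proof -
  have "{..n} = insert n {..<n}" by auto
  then show ?thesis unfolding lin_def by (simp add: circle_env_def)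
qed

primrec tm_vars :: "tm \<Rightarrow> nat set" where
  "tm_vars (Var k) = {k}"
| "tm_vars (Plus s t) = tm_vars s \<union> tm_vars t"

primrec fm_vars :: "fm \<Rightarrow> nat set" where
  "fm_vars (Eq s t) = tm_vars s \<union> tm_vars t"
| "fm_vars (Rel s t u) = tm_vars s \<union> tm_vars t \<union> tm_vars u"
| "fm_vars (Neg p) = fm_vars p"
| "fm_vars (Conj p q) = fm_vars p \<union> fm_vars q"
| "fm_vars (Ex k p) = insert k (fm_vars p)"

lemma finite_tm_vars: "finite (tm_vars t)"
  by (induction t) auto

lemma finite_fm_vars: "finite (fm_vars p)"
  by (induction p) (auto simp: finite_tm_vars)

lemma tm_val_linear:
  assumes "tm_vars t \<subseteq> {..<n}"
  shows "\<exists>c K. (\<forall>i. \<bar>c i\<bar> \<le> int K) \<and> (\<forall>e. tm_val e t = (\<Sum>i<n. c i * e i))"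
  using assms
proof (induction t)
  case (Var k)
  then have k: "k < n" by simp
  have "e k = (\<Sum>i<n. (if i = k then 1 else 0) * e i)" for e :: "nat \<Rightarrow> int"
    using k by (simp add: if_distrib [of "\<lambda>x. x * _"] cong: if_cong)
  then show ?case
    by (intro exI [of _ "\<lambda>i. if i = k then 1 else 0"] exI [of _ 1]) simp
next
  case (Plus s t)
  obtain c K where c: "\<And>i. \<bar>c i\<bar> \<le> int K" "\<And>e. tm_val e s = (\<Sum>i<n. c i * e i)"
    using Plus by auto
  obtain d L where d: "\<And>i. \<bar>d i\<bar> \<le> int L" "\<And>e. tm_val e t = (\<Sum>i<n. d i * e i)"
    using Plus by auto
  have "\<bar>c i + d i\<bar> \<le> int (K + L)" for i
    using abs_triangle_ineq [of "c i" "d i"] c(1) [of i] d(1) [of i] by simp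
  moreover have "tm_val e (Plus s t) = (\<Sum>i<n. (c i + d i) * e i)" for e
    by (simp add: c(2) d(2) sum.distrib distrib_right)
  ultimately show ?case
    by (intro exI [of _ "\<lambda>i. c i + d i"] exI [of _ "K + L"]) simp
qed

text \<open>
  Replacing \<open>\<alpha> * e i\<close> by its fractional part changes the combination by an integer.
\<close>

lemma frac_linear:
  "frac (\<alpha> * of_int (\<Sum>i<n. c i * e i)) = frac (\<Sum>i<n. of_int (c i) * frac (\<alpha> * of_int (e i)))"
proof -
  have "\<alpha> * of_int (\<Sum>i<n. c i * e i) =
      (\<Sum>i<n. of_int (c i) * (frac (\<alpha> * of_int (e i)) + of_int \<lfloor>\<alpha> * of_int (e i)\<rfloor>))"
    by (simp add: sum_distrib_left frac_def mult.left_commute)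
  also have "\<dots> = (\<Sum>i<n. of_int (c i) * frac (\<alpha> * of_int (e i))) +
      of_int (\<Sum>i<n. c i * \<lfloor>\<alpha> * of_int (e i)\<rfloor>)"
    by (simp add: distrib_left sum.distrib)
  finally show ?thesis by (simp only: frac_add_of_int_right)
qed

lemma abs_sum_frac_le:
  assumes "\<And>i. \<bar>c i\<bar> \<le> int K"
  shows "\<bar>\<Sum>i<n. of_int (c i) * frac (f i :: real)\<bar> \<le> of_int (int (n * K))"
proof -
  have "\<bar>of_int (c i) * frac (f i)\<bar> \<le> real K" for i
  proof -
    have "\<bar>of_int (c i) * frac (f i)\<bar> = of_int \<bar>c i\<bar> * frac (f i)" by (simp add: abs_mult)
    also have "\<dots> \<le> of_int \<bar>c i\<bar> * 1"
      by (intro mult_left_mono) (simp_all add: less_imp_le frac_lt_1)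
    also have "\<dots> \<le> of_int (int K)" using assms [of i] by (simp only: mult_1_right of_int_le_iff)
    finally show ?thesis by simp
  qed
  then have "(\<Sum>i<n. \<bar>of_int (c i) * frac (f i)\<bar>) \<le> (\<Sum>i<n. real K)" by (intro sum_mono)
  then show ?thesis by (intro order_trans [OF sum_abs]) simp
qed

lemma sgn_diff_eqD:
  fixes a b c d :: real
  assumes "sgn (a - b) = sgn (c - d)"
  shows "a < b \<longleftrightarrow> c < d" "a = b \<longleftrightarrow> c = d"
  using assms by (auto simp: sgn_if split: if_splits)

text \<open>
  The carry produced by adding circle coordinates is bounded by the coefficients, so it is
  determined by finitely many comparisons of the sum with integers, and these are signs of affine
  combinations. The bound leaves room for the two comparisons with the floor and with its successor.
\<close>

lemma floor_linear_invariant: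
  assumes c: "\<And>i. \<bar>c i\<bar> \<le> int K"
    and sim: "sim \<alpha> {..n} (K + n * K + 1) M (circle_env \<alpha> n e) (circle_env \<alpha> n e')"
  shows "\<lfloor>\<Sum>i<n. of_int (c i) * frac (\<alpha> * of_int (e i))\<rfloor> =
         \<lfloor>\<Sum>i<n. of_int (c i) * frac (\<alpha> * of_int (e' i))\<rfloor>" (is "\<lfloor>?y\<rfloor> = \<lfloor>?y'\<rfloor>")
proof -
  have inv: "sgn (?y - of_int d) = sgn (?y' - of_int d)" if "\<bar>d\<bar> \<le> int (n * K) + 1" for d
  proof -
    have "\<bar>(c(n := - d)) i\<bar> \<le> int (K + n * K + 1)" for i
      using c [of i] that by (auto intro: order_trans)
    then have "sgn (lin {..n} (c(n := - d)) (circle_env \<alpha> n e)) = sgn (lin {..n} (c(n := - d)) (circle_env \<alpha> n e'))"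
      by (intro sim_sgn [OF sim])
    then show ?thesis by (simp add: lin_circle_env)
  qed
  have "\<bar>?y\<bar> \<le> of_int (int (n * K))" using c by (rule abs_sum_frac_le)
  then have "- int (n * K) \<le> \<lfloor>?y\<rfloor>" "\<lfloor>?y\<rfloor> \<le> int (n * K)"
    by (simp_all only: le_floor_iff floor_le_iff abs_le_iff) linarith+
  then have b: "\<bar>\<lfloor>?y\<rfloor>\<bar> \<le> int (n * K) + 1" "\<bar>\<lfloor>?y\<rfloor> + 1\<bar> \<le> int (n * K) + 1" by linarith+
  have "\<not> ?y < of_int \<lfloor>?y\<rfloor>" "?y < of_int (\<lfloor>?y\<rfloor> + 1)" by linarith+
  then have "\<not> ?y' < of_int \<lfloor>?y\<rfloor>" "?y' < of_int (\<lfloor>?y\<rfloor> + 1)"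
    unfolding sgn_diff_eqD(1) [OF inv [OF b(1)]] sgn_diff_eqD(1) [OF inv [OF b(2)]] .
  then have "\<lfloor>?y'\<rfloor> = \<lfloor>?y\<rfloor>" by (intro floor_unique) simp_all
  then show ?thesis by simp
qed

text \<open>
  The circle coordinate of a term is a linear combination minus its carry. Similar environments
  produce the same carries, so comparing two terms is the sign of one affine combination
  with a common constant.
\<close>

lemma term_order_invariant:
  assumes "tm_vars s \<subseteq> {..<n}" "tm_vars t \<subseteq> {..<n}"
  shows "\<exists>N. \<forall>M e e'. sim \<alpha> {..n} N M (circle_env \<alpha> n e) (circle_env \<alpha> n e') \<longrightarrow>
    sgn (frac (\<alpha> * of_int (tm_val e s)) - frac (\<alpha> * of_int (tm_val e t))) =
    sgn (frac (\<alpha> * of_int (tm_val e' s)) - frac (\<alpha> * of_int (tm_val e' t)))"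
proof -
  obtain c K1 where c: "\<And>i. \<bar>c i\<bar> \<le> int K1" "\<And>e. tm_val e s = (\<Sum>i<n. c i * e i)"
    using tm_val_linear [OF assms(1)] by blast
  obtain d K2 where d: "\<And>i. \<bar>d i\<bar> \<le> int K2" "\<And>e. tm_val e t = (\<Sum>i<n. d i * e i)"
    using tm_val_linear [OF assms(2)] by blast
  define K where "K = K1 + K2"
  have cK: "\<bar>c i\<bar> \<le> int K" and dK: "\<bar>d i\<bar> \<le> int K" for i
    using c(1) [of i] d(1) [of i] by (simp_all add: K_def)
  define y where "y = (\<lambda>c e. \<Sum>i<n. of_int (c i) * frac (\<alpha> * of_int (e i)))"
  have val: "frac (\<alpha> * of_int (tm_val e s)) = y c e - of_int \<lfloor>y c e\<rfloor>"
       "frac (\<alpha> * of_int (tm_val e t)) = y d e - of_int \<lfloor>y d e\<rfloor>" for e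
    unfolding y_def frac_def [of "sum _ _", symmetric] by (simp_all only: c(2) d(2) frac_linear)
  have "sgn (frac (\<alpha> * of_int (tm_val e s)) - frac (\<alpha> * of_int (tm_val e t))) =
    sgn (frac (\<alpha> * of_int (tm_val e' s)) - frac (\<alpha> * of_int (tm_val e' t)))"
    if sim: "sim \<alpha> {..n} (2 * (K + n * K + 1)) M (circle_env \<alpha> n e) (circle_env \<alpha> n e')" for M e e'
  proof -
    have sim': "sim \<alpha> {..n} (K + n * K + 1) M (circle_env \<alpha> n e) (circle_env \<alpha> n e')"
      using sim by (rule sim_mono) auto
    have eq: "\<lfloor>y c e\<rfloor> = \<lfloor>y c e'\<rfloor>" "\<lfloor>y d e\<rfloor> = \<lfloor>y d e'\<rfloor>"
      unfolding y_def using floor_linear_invariant [OF _ sim'] cK dK by blast+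
    have bound: "\<bar>\<lfloor>y c e\<rfloor>\<bar> \<le> int (n * K)" "\<bar>\<lfloor>y d e\<rfloor>\<bar> \<le> int (n * K)"
    proof -
      have "\<bar>y c e\<bar> \<le> of_int (int (n * K))" "\<bar>y d e\<bar> \<le> of_int (int (n * K))"
        unfolding y_def using cK dK by (intro abs_sum_frac_le; blast)+
      then show "\<bar>\<lfloor>y c e\<rfloor>\<bar> \<le> int (n * K)" "\<bar>\<lfloor>y d e\<rfloor>\<bar> \<le> int (n * K)" by linarith+
    qed
    define w where "w = (\<lambda>i. c i - d i)(n := \<lfloor>y d e\<rfloor> - \<lfloor>y c e\<rfloor>)"
    have "\<bar>w i\<bar> \<le> int (2 * (K + n * K + 1))" for i
    proof (cases "i = n")
      case True
      then have "w i = \<lfloor>y d e\<rfloor> - \<lfloor>y c e\<rfloor>" by (simp add: w_def)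
      then have "\<bar>w i\<bar> \<le> 2 * int (n * K)" using bound by linarith
      also have "\<dots> \<le> int (2 * (K + n * K + 1))" by simp
      finally show ?thesis .
    next
      case False
      then have "w i = c i - d i" by (simp add: w_def)
      then have "\<bar>w i\<bar> \<le> 2 * int K" using cK [of i] dK [of i] by linarith
      also have "\<dots> \<le> int (2 * (K + n * K + 1))" by simp
      finally show ?thesis .
    qed
    then have "sgn (lin {..n} w (circle_env \<alpha> n e)) = sgn (lin {..n} w (circle_env \<alpha> n e'))"
      by (intro sim_sgn [OF sim])
    moreover have "lin {..n} w (circle_env \<alpha> n f) = y c f - y d f - (of_int \<lfloor>y c e\<rfloor> - of_int \<lfloor>y d e\<rfloor>)" for f
      by (simp add: lin_circle_env w_def y_def sum_subtractf left_diff_distrib)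
    ultimately show ?thesis by (simp add: val eq algebra_simps)
  qed
  then show ?thesis by blast
qed

text \<open>
  Atomic formulas are decided by comparisons of circle coordinates, and equality of integers is
  equality of coordinates because \<open>\<alpha>\<close> is irrational. The quantifier step is the back-and-forth
  property; the entry that it supplies must in addition be the coordinate of an integer. It lies
  in $\mathbb{Z} + \alpha\mathbb{Z}$ since the coordinate of the given witness does, and it lies in $[0,1)$
  because the signs of \<open>r\<close> and \<open>r - 1\<close> are part of the preserved data.
\<close>

lemma sat_invariant:
  assumes irr: "\<alpha> \<notin> \<rat>" and "fm_vars p \<subseteq> {..<n}"
  shows "\<exists>N M. M > 0 \<and> (\<forall>e e'. sim \<alpha> {..n} N M (circle_env \<alpha> n e) (circle_env \<alpha> n e') \<longrightarrow>
           sat (cyc \<alpha>) e p = sat (cyc \<alpha>) e' p)"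
  using assms(2)
proof (induction p)
  case (Eq s t)
  then obtain N where N: "\<And>M e e'. sim \<alpha> {..n} N M (circle_env \<alpha> n e) (circle_env \<alpha> n e') \<Longrightarrow>
    sgn (frac (\<alpha> * of_int (tm_val e s)) - frac (\<alpha> * of_int (tm_val e t))) =
    sgn (frac (\<alpha> * of_int (tm_val e' s)) - frac (\<alpha> * of_int (tm_val e' t)))"
    using term_order_invariant [of s n t \<alpha>] by auto
  have "sat (cyc \<alpha>) e (Eq s t) = sat (cyc \<alpha>) e' (Eq s t)"
    if "sim \<alpha> {..n} N 1 (circle_env \<alpha> n e) (circle_env \<alpha> n e')" for e e'
    using sgn_diff_eqD(2) [OF N [OF that]] by (simp add: frac_inject_irrational [OF irr])
  then show ?case by (intro exI [of _ N] exI [of _ 1]) simp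
next
  case (Rel s t u)
  define ord where "ord = (\<lambda>e s t. frac (\<alpha> * of_int (tm_val e s)) < frac (\<alpha> * of_int (tm_val e t)))"
  have ord: "\<exists>N. \<forall>M e e'. sim \<alpha> {..n} N M (circle_env \<alpha> n e) (circle_env \<alpha> n e') \<longrightarrow> ord e s t = ord e' s t"
    if "tm_vars s \<subseteq> {..<n}" "tm_vars t \<subseteq> {..<n}" for s t
    using term_order_invariant [OF that, of \<alpha>] unfolding ord_def by (meson sgn_diff_eqD(1))
  obtain N1 where N1: "\<And>M e e'. sim \<alpha> {..n} N1 M (circle_env \<alpha> n e) (circle_env \<alpha> n e') \<Longrightarrow> ord e s t = ord e' s t"
    using ord [of s t] Rel by auto
  obtain N2 where N2: "\<And>M e e'. sim \<alpha> {..n} N2 M (circle_env \<alpha> n e) (circle_env \<alpha> n e') \<Longrightarrow> ord e t u = ord e' t u"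
    using ord [of t u] Rel by auto
  obtain N3 where N3: "\<And>M e e'. sim \<alpha> {..n} N3 M (circle_env \<alpha> n e) (circle_env \<alpha> n e') \<Longrightarrow> ord e u s = ord e' u s"
    using ord [of u s] Rel by auto
  have "sat (cyc \<alpha>) e (Rel s t u) = sat (cyc \<alpha>) e' (Rel s t u)"
    if sim: "sim \<alpha> {..n} (N1 + N2 + N3) 1 (circle_env \<alpha> n e) (circle_env \<alpha> n e')" for e e'
  proof -
    have "ord e s t = ord e' s t" by (rule N1, rule sim_mono [OF sim]) auto
    moreover have "ord e t u = ord e' t u" by (rule N2, rule sim_mono [OF sim]) auto
    moreover have "ord e u s = ord e' u s" by (rule N3, rule sim_mono [OF sim]) auto
    ultimately show ?thesis unfolding ord_def by (simp add: cyc_iff_frac Let_def)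
  qed
  then show ?case by (intro exI [of _ "N1 + N2 + N3"] exI [of _ 1]) simp
next
  case (Neg p)
  then show ?case by simp
next
  case (Conj p q)
  obtain N1 M1 where 1: "M1 > 0" "\<And>e e'. sim \<alpha> {..n} N1 M1 (circle_env \<alpha> n e) (circle_env \<alpha> n e') \<Longrightarrow>
      sat (cyc \<alpha>) e p = sat (cyc \<alpha>) e' p" using Conj by auto
  obtain N2 M2 where 2: "M2 > 0" "\<And>e e'. sim \<alpha> {..n} N2 M2 (circle_env \<alpha> n e) (circle_env \<alpha> n e') \<Longrightarrow>
      sat (cyc \<alpha>) e q = sat (cyc \<alpha>) e' q" using Conj by auto
  have "sat (cyc \<alpha>) e (Conj p q) = sat (cyc \<alpha>) e' (Conj p q)"
    if sim: "sim \<alpha> {..n} (N1 + N2) (M1 * M2) (circle_env \<alpha> n e) (circle_env \<alpha> n e')" for e e'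
  proof -
    have "sat (cyc \<alpha>) e p = sat (cyc \<alpha>) e' p" by (rule 1(2), rule sim_mono [OF sim]) auto
    moreover have "sat (cyc \<alpha>) e q = sat (cyc \<alpha>) e' q" by (rule 2(2), rule sim_mono [OF sim]) auto
    ultimately show ?thesis by simp
  qed
  then show ?case using 1(1) 2(1) by (intro exI [of _ "N1 + N2"] exI [of _ "M1 * M2"]) simp
next
  case (Ex i p)
  then have i: "i < n" by simp
  obtain N M where NM: "M > 0" "\<And>e e'. sim \<alpha> {..n} N M (circle_env \<alpha> n e) (circle_env \<alpha> n e') \<Longrightarrow>
      sat (cyc \<alpha>) e p = sat (cyc \<alpha>) e' p" using Ex by auto
  \<comment> \<open>Level \<open>N + 1\<close> instead of \<open>N\<close>, since coefficients of size 1 are needed for the bounds 0 and 1.\<close>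
  define N' where "N' = 2 * (fact (N + 1) * (N + 1))"
  define M' where "M' = fact (N + 1) * M"
  have step: "sat (cyc \<alpha>) e' (Ex i p)"
    if sim: "sim \<alpha> {..n} N' M' (circle_env \<alpha> n e) (circle_env \<alpha> n e')" and sat: "sat (cyc \<alpha>) e (Ex i p)" for e e'
  proof -
    obtain x where x: "sat (cyc \<alpha>) (e(i := x)) p" using sat by auto
    define r where "r = frac (\<alpha> * of_int x)"
    have "i \<in> {..n}" using i by simp
    then obtain h where h: "h \<in> int_span \<alpha>"
      "sim \<alpha> {..n} (N + 1) M ((circle_env \<alpha> n e)(i := r)) ((circle_env \<alpha> n e')(i := r + of_nat M * h))"
      using back_and_forth [OF irr _ _ NM(1), of "{..n}" i "N + 1" "circle_env \<alpha> n e" "circle_env \<alpha> n e'"] sim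
      unfolding N'_def M'_def by blast
    define r' where "r' = r + of_nat M * h"
    have r': "0 \<le> r'" "r' < 1"
    proof -
      let ?E = "(circle_env \<alpha> n e)(i := r)" and ?E' = "(circle_env \<alpha> n e')(i := r')"
      have lin: "lin {..n} ((\<lambda>_. 0)(i := a, n := b)) (E(i := y)) = of_int a * y + of_int b"
        if "E n = 1" for a b y and E :: "nat \<Rightarrow> real"
      proof -
        have "{..n} = insert i (insert n ({..n} - {i, n}))" using i by auto
        then have "lin {..n} ((\<lambda>_. 0)(i := a, n := b)) (E(i := y)) =
          (\<Sum>j\<in>insert i (insert n ({..n} - {i, n})). of_int (((\<lambda>_. 0)(i := a, n := b)) j) * (E(i := y)) j)"
          unfolding lin_def by metis
        also have "\<dots> = of_int a * y + of_int b" using i that by simp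
        finally show ?thesis .
      qed
      have "sgn (of_int a * r + of_int b :: real) = sgn (of_int a * r' + of_int b)"
        if "\<bar>a\<bar> \<le> 1" "\<bar>b\<bar> \<le> 1" for a b
        using sim_sgn [OF h(2), of "(\<lambda>_. 0)(i := a, n := b)"] that
        by (simp add: lin circle_env_def r'_def)
      from this [of 1 0] this [of 1 "-1"]
      have "sgn (r - 0) = sgn (r' - 0)" "sgn (r - 1) = sgn (r' - 1)" by simp_all
      from this [THEN sgn_diff_eqD(1)] have "r < 0 \<longleftrightarrow> r' < 0" "r < 1 \<longleftrightarrow> r' < 1" .
      moreover have "0 \<le> r" "r < 1" unfolding r_def by (simp_all add: frac_lt_1)
      ultimately show "0 \<le> r'" "r' < 1" by simp_all
    qed
    have "r = \<alpha> * of_int x + of_int (- \<lfloor>\<alpha> * of_int x\<rfloor>)" unfolding r_def by (simp add: frac_def)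
    then have "r \<in> int_span \<alpha>" unfolding int_span_def by blast
    then have "r' \<in> int_span \<alpha>"
      unfolding r'_def using int_span_add int_span_int_mult [OF h(1), of "int M"] by simp
    then obtain z k where z: "r' = \<alpha> * of_int z + of_int k" unfolding int_span_def by blast
    then have "frac (\<alpha> * of_int z) = r'" using r' by (simp add: frac_unique_iff)
    then have "sim \<alpha> {..n} (N + 1) M (circle_env \<alpha> n (e(i := x))) (circle_env \<alpha> n (e'(i := z)))"
      using h(2) by (simp add: circle_env_update [OF i] r_def r'_def)
    then have "sim \<alpha> {..n} N M (circle_env \<alpha> n (e(i := x))) (circle_env \<alpha> n (e'(i := z)))"
      by (rule sim_mono) auto
    then show ?thesis using NM(2) x by auto
  qed
  have "M' > 0" using NM(1) unfolding M'_def by simp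
  moreover have "sat (cyc \<alpha>) e (Ex i p) = sat (cyc \<alpha>) e' (Ex i p)"
    if "sim \<alpha> {..n} N' M' (circle_env \<alpha> n e) (circle_env \<alpha> n e')" for e e'
    using step [OF that] step [OF sim_sym [OF that]] by blast
  ultimately show ?case by blast
qed

section \<open>Similarity classes in one variable\<close>

text \<open>
  Lifted to the real line, the open arc of the circle from \<open>a\<close> to \<open>b\<close> is the open interval between
  any two lifts of \<open>a\<close> and \<open>b\<close> at distance less than 1. With the fractional parts as reference,
  the two integer parts agree if the arc does not pass through 0, and differ by 1 if it does.
\<close>

lemma cyc_between:
  assumes "cyc \<alpha> a t b"
    and "\<alpha> * of_int a + of_int k < \<alpha> * of_int b + of_int l"
    and "\<alpha> * of_int b + of_int l < \<alpha> * of_int a + of_int k + 1"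
  shows "\<exists>m. \<alpha> * of_int a + of_int k < \<alpha> * of_int t + of_int m \<and>
             \<alpha> * of_int t + of_int m < \<alpha> * of_int b + of_int l"
proof -
  define A B T where "A = frac (\<alpha> * of_int a)" "B = frac (\<alpha> * of_int b)" "T = frac (\<alpha> * of_int t)"
  define p where "p = \<lfloor>\<alpha> * of_int a\<rfloor> + k"
  define q where "q = \<lfloor>\<alpha> * of_int b\<rfloor> + l"
  have a: "\<alpha> * of_int a + of_int k = A + of_int p" by (simp add: A_B_T_def p_def frac_def)
  have b: "\<alpha> * of_int b + of_int l = B + of_int q" by (simp add: A_B_T_def q_def frac_def)
  have t: "\<alpha> * of_int t + of_int (m - \<lfloor>\<alpha> * of_int t\<rfloor>) = T + of_int m" for m
    by (simp add: A_B_T_def frac_def)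
  have range: "0 \<le> A" "A < 1" "0 \<le> B" "B < 1" "0 \<le> T" "T < 1"
    by (simp_all add: A_B_T_def frac_lt_1)
  have ord: "A < T \<and> T < B \<or> T < B \<and> B < A \<or> B < A \<and> A < T"
    using assms(1) by (simp add: cyc_iff_frac A_B_T_def Let_def)
  have less: "A + of_int p < B + of_int q" "B + of_int q < A + of_int p + 1"
    using assms(2,3) unfolding a b .
  then have "of_int p - 1 < (of_int q :: real)" "of_int q < (of_int p + 2 :: real)"
    using range by linarith+
  then have "q = p \<or> q = p + 1" by linarith
  then have "\<exists>m. A + of_int p < T + of_int m \<and> T + of_int m < B + of_int q"
  proof
    assume "q = p"
    then show ?thesis using ord less by (intro exI [of _ p]) auto
  next
    assume q: "q = p + 1"
    show ?thesis
    proof (cases "A < T")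
      case True
      then show ?thesis using q less range by (intro exI [of _ p]) auto
    next
      case False
      then show ?thesis using q less ord range by (intro exI [of _ "p + 1"]) auto
    qed
  qed
  then show ?thesis unfolding a b by (metis t)
qed

text \<open>
  An element \<open>y\<close> of the set satisfies \<open>y = x + M * g\<close>, where \<open>g\<close> is an integer such that some lift of
  its point on the circle lies in the interval obtained from \<open>I\<close> by translation and division by \<open>M\<close>.
  As \<open>I\<close> lies in $[0,1)$, that interval has length at most $1/M \le 1$, hence it embeds in the circle
  as an arc and the integers \<open>g\<close> form a convex set.
\<close>

lemma tmc_set_arc_progression:
  fixes I :: "real set"
  assumes irr: "\<alpha> \<notin> \<rat>" and M: "M > 0" and I: "I \<subseteq> {0..<1}"
    and conv: "\<And>r s t. r \<in> I \<Longrightarrow> t \<in> I \<Longrightarrow> r < s \<Longrightarrow> s < t \<Longrightarrow> s \<in> I"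
  shows "tmc_set (cyc \<alpha>) {y. frac (\<alpha> * of_int y) \<in> I \<and>
           (\<exists>h\<in>int_span \<alpha>. frac (\<alpha> * of_int y) = frac (\<alpha> * of_int x) + of_nat M * h)}"
    (is "tmc_set _ ?S")
proof -
  define r where "r = frac (\<alpha> * of_int x)"
  define J where "J = {g. \<exists>k. r + M * (\<alpha> * of_int g + of_int k) \<in> I}"
  have arc: "{t. cyc \<alpha> a t b} \<subseteq> J"
    if ab: "r + M * (\<alpha> * of_int a + of_int k) \<in> I" "r + M * (\<alpha> * of_int b + of_int l) \<in> I"
      and less: "\<alpha> * of_int a + of_int k < \<alpha> * of_int b + of_int l" for a b k l
  proof
    fix t assume "t \<in> {t. cyc \<alpha> a t b}"
    then have t: "cyc \<alpha> a t b" by simp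
    have "r + M * (\<alpha> * of_int b + of_int l) < 1" "0 \<le> r + M * (\<alpha> * of_int a + of_int k)"
      using I ab by force+
    then have "M * ((\<alpha> * of_int b + of_int l) - (\<alpha> * of_int a + of_int k)) < 1"
      unfolding right_diff_distrib by linarith
    also have "1 \<le> real M" using M by simp
    finally have "real M * ((\<alpha> * of_int b + of_int l) - (\<alpha> * of_int a + of_int k)) < real M * 1" by simp
    then have "(\<alpha> * of_int b + of_int l) - (\<alpha> * of_int a + of_int k) < 1"
      using M by (simp only: mult_less_cancel_left_pos of_nat_0_less_iff)
    then have "\<alpha> * of_int b + of_int l < \<alpha> * of_int a + of_int k + 1" by simp
    then obtain m where m: "\<alpha> * of_int a + of_int k < \<alpha> * of_int t + of_int m"
      "\<alpha> * of_int t + of_int m < \<alpha> * of_int b + of_int l"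
      using cyc_between [OF t less] by blast
    have "r + M * (\<alpha> * of_int t + of_int m) \<in> I"
      using M m by (intro conv [OF ab]) simp_all
    then show "t \<in> J" unfolding J_def by blast
  qed
  have "cyc_convex (cyc \<alpha>) J"
    unfolding cyc_convex_def
  proof (intro ballI impI)
    fix a b assume "a \<in> J" "b \<in> J" "a \<noteq> b"
    then obtain k l where kl: "r + M * (\<alpha> * of_int a + of_int k) \<in> I"
      "r + M * (\<alpha> * of_int b + of_int l) \<in> I" unfolding J_def by blast
    have "\<alpha> * of_int a + of_int k \<noteq> \<alpha> * of_int b + of_int l"
    proof
      assume "\<alpha> * of_int a + of_int k = \<alpha> * of_int b + of_int l"
      then have "\<alpha> * of_int a - \<alpha> * of_int b = of_int (l - k)" by (simp add: algebra_simps)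
      then have "\<alpha> * of_int a - \<alpha> * of_int b \<in> \<int>" by (metis Ints_of_int)
      then show False using irrational_mult_int_diff [OF irr] \<open>a \<noteq> b\<close> by blast
    qed
    then consider "\<alpha> * of_int a + of_int k < \<alpha> * of_int b + of_int l"
      | "\<alpha> * of_int b + of_int l < \<alpha> * of_int a + of_int k" by linarith
    then show "{t. cyc \<alpha> a t b} \<subseteq> J \<or> {t. cyc \<alpha> b t a} \<subseteq> J"
      using arc kl by cases blast+
  qed
  moreover have "?S = {x + int M * g | g. g \<in> J}"
  proof (intro set_eqI iffI)
    fix y assume y: "y \<in> ?S"
    then obtain h where "h \<in> int_span \<alpha>" "frac (\<alpha> * of_int y) = r + of_nat M * h"
      unfolding r_def by blast
    then obtain g k where g: "frac (\<alpha> * of_int y) = r + M * (\<alpha> * of_int g + of_int k)"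
      unfolding int_span_def by blast
    have "\<alpha> * of_int y - \<alpha> * of_int (x + int M * g) =
        of_int (\<lfloor>\<alpha> * of_int y\<rfloor> - \<lfloor>\<alpha> * of_int x\<rfloor> + int M * k)"
      using g unfolding r_def frac_def by (simp add: algebra_simps)
    then have "\<alpha> * of_int y - \<alpha> * of_int (x + int M * g) \<in> \<int>" by (metis Ints_of_int)
    then have "y = x + int M * g" using irrational_mult_int_diff [OF irr] by blast
    moreover have "g \<in> J" using y g unfolding J_def by auto
    ultimately show "y \<in> {x + int M * g | g. g \<in> J}" by blast
  next
    fix y assume "y \<in> {x + int M * g | g. g \<in> J}"
    then obtain g k where g: "y = x + int M * g" "r + M * (\<alpha> * of_int g + of_int k) \<in> I"
      unfolding J_def by blast
    have "\<alpha> * of_int y - (r + M * (\<alpha> * of_int g + of_int k)) = of_int (\<lfloor>\<alpha> * of_int x\<rfloor> - int M * k)"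
      unfolding g(1) r_def frac_def by (simp add: algebra_simps)
    then have "\<alpha> * of_int y - (r + M * (\<alpha> * of_int g + of_int k)) \<in> \<int>" by (metis Ints_of_int)
    moreover have "0 \<le> r + M * (\<alpha> * of_int g + of_int k)" "r + M * (\<alpha> * of_int g + of_int k) < 1"
      using g(2) I by force+
    ultimately have "frac (\<alpha> * of_int y) = r + M * (\<alpha> * of_int g + of_int k)"
      by (simp only: frac_unique_iff)
    moreover have "\<alpha> * of_int g + of_int k \<in> int_span \<alpha>" unfolding int_span_def by blast
    ultimately show "y \<in> ?S" using g(2) unfolding r_def by auto
  qed
  ultimately show ?thesis unfolding tmc_set_def by blast
qed

text \<open>
  An affine function is monotone, and the sets where the sign is \<open>-1\<close>, \<open>0\<close> or \<open>1\<close> are convex.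
\<close>

lemma sgn_affine_between:
  fixes r s t c k :: real
  assumes "sgn (c * r + k) = \<sigma>" "sgn (c * t + k) = \<sigma>" "r < s" "s < t"
  shows "sgn (c * s + k) = \<sigma>"
proof (cases "c \<ge> 0")
  case True
  then have "c * r \<le> c * s" "c * s \<le> c * t" using assms by (simp_all add: mult_left_mono)
  then show ?thesis using assms(1,2) by (auto simp: sgn_if split: if_splits)
next
  case False
  then have "c * s \<le> c * r" "c * t \<le> c * s" using assms by (simp_all add: mult_left_mono_neg)
  then show ?thesis using assms(1,2) by (auto simp: sgn_if split: if_splits)
qed

text \<open>
  The entries other than \<open>i\<close> agree, so each sign condition is a condition on an affine function of the
  coordinate of \<open>y\<close> and cuts out a convex set; the congruence conditions reduce to the one at \<open>i\<close>.
\<close>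

lemma tmc_set_sim_class:
  assumes irr: "\<alpha> \<notin> \<rat>" and M: "M > 0" and n: "i < n"
  shows "tmc_set (cyc \<alpha>) {y. sim \<alpha> {..n} N M (circle_env \<alpha> n (e(i := x))) (circle_env \<alpha> n (e(i := y)))}"
proof -
  define E where "E = (\<lambda>t. (circle_env \<alpha> n e)(i := t))"
  define X where "X = E (frac (\<alpha> * of_int x))"
  define I where "I = {t \<in> {0..<1}. \<forall>c. (\<forall>i\<in>{..n}. \<bar>c i\<bar> \<le> int N) \<longrightarrow>
                        sgn (lin {..n} c X) = sgn (lin {..n} c (E t))}"
  have lin: "lin {..n} c (E t) = of_int (c i) * t + lin {..n} (c(i := 0)) (circle_env \<alpha> n e)" for c t
    unfolding E_def using n by (intro lin_update) auto
  have conv: "s \<in> I" if "r \<in> I" "t \<in> I" "r < s" "s < t" for r s t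
  proof -
    have "sgn (lin {..n} c (E s)) = sgn (lin {..n} c X)" if "\<forall>i\<in>{..n}. \<bar>c i\<bar> \<le> int N" for c
    proof -
      have "sgn (lin {..n} c (E r)) = sgn (lin {..n} c X)" "sgn (lin {..n} c (E t)) = sgn (lin {..n} c X)"
        using \<open>r \<in> I\<close> \<open>t \<in> I\<close> that unfolding I_def by simp_all
      then show ?thesis
        unfolding lin [of c r] lin [of c s] lin [of c t]
        by (rule sgn_affine_between [OF _ _ \<open>r < s\<close> \<open>s < t\<close>])
    qed
    moreover have "0 \<le> s" "s < 1" using that unfolding I_def by simp_all
    ultimately show ?thesis unfolding I_def by simp
  qed
  have "I \<subseteq> {0..<1}" unfolding I_def by blast
  then have "tmc_set (cyc \<alpha>) {y. frac (\<alpha> * of_int y) \<in> I \<and>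
      (\<exists>h\<in>int_span \<alpha>. frac (\<alpha> * of_int y) = frac (\<alpha> * of_int x) + of_nat M * h)}"
    using conv by (rule tmc_set_arc_progression [OF irr M])
  moreover have "sim \<alpha> {..n} N M (circle_env \<alpha> n (e(i := x))) (circle_env \<alpha> n (e(i := y))) \<longleftrightarrow>
      frac (\<alpha> * of_int y) \<in> I \<and>
      (\<exists>h\<in>int_span \<alpha>. frac (\<alpha> * of_int y) = frac (\<alpha> * of_int x) + of_nat M * h)" for y
  proof -
    have "(\<forall>j\<in>{..n}. \<exists>h\<in>int_span \<alpha>. E (frac (\<alpha> * of_int y)) j = X j + of_nat M * h) \<longleftrightarrow>
        (\<exists>h\<in>int_span \<alpha>. frac (\<alpha> * of_int y) = frac (\<alpha> * of_int x) + of_nat M * h)"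
    proof -
      have "\<exists>h\<in>int_span \<alpha>. u = u + real M * h" for u using int_span_0 by force
      then show ?thesis using n unfolding X_def E_def by auto
    qed
    moreover have "frac (\<alpha> * of_int y) \<in> I \<longleftrightarrow> (\<forall>c. (\<forall>i\<in>{..n}. \<bar>c i\<bar> \<le> int N) \<longrightarrow>
                        sgn (lin {..n} c X) = sgn (lin {..n} c (E (frac (\<alpha> * of_int y)))))"
      unfolding I_def by (simp add: frac_lt_1)
    ultimately show ?thesis
      unfolding sim_def circle_env_update [OF n] X_def E_def by simp
  qed
  ultimately show ?thesis by simp
qed

text \<open>
  A class is determined by finitely many signs and by the residues modulo \<open>M\<close> of \<open>x\<close> and of
  \<open>\<lfloor>\<alpha> * x\<rfloor>\<close>, the two integer coordinates of \<open>frac (\<alpha> * x)\<close> in $\mathbb{Z} + \alpha\mathbb{Z}$.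
\<close>

lemma finite_sim_classes:
  assumes M: "M > 0"
  shows "finite (range (\<lambda>x. {y. sim \<alpha> {..n} N M (circle_env \<alpha> n (e(i := x))) (circle_env \<alpha> n (e(i := y)))}))"
    (is "finite (range ?cl)")
proof -
  define Cs where "Cs = ({..n} \<rightarrow>\<^sub>E {- int N..int N})"
  define E where "E = (\<lambda>x. circle_env \<alpha> n (e(i := x)))"
  define key where "key = (\<lambda>x. (\<lambda>c\<in>Cs. sgn (lin {..n} c (E x)), x mod int M, \<lfloor>\<alpha> * of_int x\<rfloor> mod int M))"
  have "finite Cs" unfolding Cs_def by (intro finite_PiE) auto
  then have "finite (Cs \<rightarrow>\<^sub>E {- 1, 0, 1 :: real})" by (intro finite_PiE) auto
  then have "finite ((Cs \<rightarrow>\<^sub>E {- 1, 0, 1 :: real}) \<times> {0..<int M} \<times> {0..<int M})" by simp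
  moreover have "range key \<subseteq> (Cs \<rightarrow>\<^sub>E {- 1, 0, 1}) \<times> {0..<int M} \<times> {0..<int M}"
    using M by (auto simp: key_def sgn_if split: if_splits)
  ultimately have fin: "finite (range key)" by (rule finite_subset [rotated])
  have sim: "sim \<alpha> {..n} N M (E x) (E y)" if key: "key x = key y" for x y
    unfolding sim_def
  proof (intro conjI allI impI ballI)
    fix c assume c: "\<forall>j\<in>{..n}. \<bar>c j\<bar> \<le> int N"
    have "c j \<in> {- int N..int N}" if "j \<in> {..n}" for j
    proof -
      have "\<bar>c j\<bar> \<le> int N" using c that by blast
      then show ?thesis unfolding atLeastAtMost_iff by linarith
    qed
    then have "restrict c {..n} \<in> Cs" unfolding Cs_def by (simp add: restrict_PiE_iff)
    moreover have "restrict (\<lambda>c. sgn (lin {..n} c (E x))) Cs = restrict (\<lambda>c. sgn (lin {..n} c (E y))) Cs"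
      using key by (simp add: key_def)
    ultimately have "sgn (lin {..n} (restrict c {..n}) (E x)) = sgn (lin {..n} (restrict c {..n}) (E y))"
      by (metis restrict_apply')
    moreover have "lin {..n} (restrict c {..n}) f = lin {..n} c f" for f by (rule lin_cong) simp
    ultimately show "sgn (lin {..n} c (E x)) = sgn (lin {..n} c (E y))" by simp
  next
    fix j assume "j \<in> {..n}"
    show "\<exists>h\<in>int_span \<alpha>. E y j = E x j + real M * h"
    proof (cases "j = i \<and> j < n")
      case True
      have "int M dvd y - x" "int M dvd \<lfloor>\<alpha> * of_int y\<rfloor> - \<lfloor>\<alpha> * of_int x\<rfloor>"
        using key by (simp_all add: key_def mod_eq_dvd_iff [symmetric])
      then obtain q r where q: "y - x = int M * q" "\<lfloor>\<alpha> * of_int y\<rfloor> - \<lfloor>\<alpha> * of_int x\<rfloor> = int M * r"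
        by (auto elim!: dvdE)
      have "E y j = E x j + (\<alpha> * of_int (y - x) - of_int (\<lfloor>\<alpha> * of_int y\<rfloor> - \<lfloor>\<alpha> * of_int x\<rfloor>))"
        using True by (simp add: E_def circle_env_def frac_def algebra_simps)
      also have "\<dots> = E x j + real M * (\<alpha> * of_int q + of_int (- r))"
        unfolding q by (simp add: algebra_simps)
      finally show ?thesis unfolding int_span_def by blast
    next
      case False
      then have "E y j = E x j + real M * 0" by (auto simp: E_def circle_env_def)
      then show ?thesis using int_span_0 by blast
    qed
  qed
  have cl: "?cl x = ?cl y" if "key x = key y" for x y
    using sim [OF that] unfolding E_def by (auto intro: sim_trans sim_sym)
  have "range ?cl \<subseteq> (\<lambda>k. ?cl (SOME z. key z = k)) ` range key"
  proof (rule image_subsetI)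
    fix x
    have "key (SOME z. key z = key x) = key x" by (rule someI) (rule refl)
    then have "?cl x = ?cl (SOME z. key z = key x)" by (intro cl) (rule sym)
    then show "?cl x \<in> (\<lambda>k. ?cl (SOME z. key z = k)) ` range key"
      by (rule image_eqI [where x = "key x"]) (rule rangeI)
  qed
  then show ?thesis using fin by (rule finite_surj [rotated])
qed

theorem theorem3p4:
  fixes \<alpha> :: real
  assumes "\<alpha> \<notin> \<rat>"
  shows "tmc_minimal (cyc \<alpha>)"
  unfolding tmc_minimal_def
proof (intro allI impI)
  fix S assume "definable (cyc \<alpha>) S"
  then obtain p e where S: "S = {x. sat (cyc \<alpha>) (e(0 := x)) p}" unfolding definable_def by blast
  obtain n where n: "fm_vars p \<subseteq> {..<n}" using finite_nat_iff_bounded finite_fm_vars by blast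
  \<comment> \<open>The successor ensures that the variable 0 is in range even if it does not occur in \<open>p\<close>.\<close>
  then have "fm_vars p \<subseteq> {..<Suc n}" by auto
  then obtain N M where M: "M > 0" and inv: "\<And>e e'.
      sim \<alpha> {..Suc n} N M (circle_env \<alpha> (Suc n) e) (circle_env \<alpha> (Suc n) e') \<Longrightarrow> sat (cyc \<alpha>) e p = sat (cyc \<alpha>) e' p"
    using sat_invariant [OF assms] by blast
  define cl where
    "cl = (\<lambda>x. {y. sim \<alpha> {..Suc n} N M (circle_env \<alpha> (Suc n) (e(0 := x))) (circle_env \<alpha> (Suc n) (e(0 := y)))})"
  have "finite (cl ` S)"
    using finite_sim_classes [OF M] unfolding cl_def by (rule finite_subset [rotated]) blast
  moreover have "\<forall>T\<in>cl ` S. tmc_set (cyc \<alpha>) T"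
    unfolding cl_def using tmc_set_sim_class [OF assms M] by blast
  moreover have "S = \<Union> (cl ` S)"
  proof (intro set_eqI iffI)
    fix x assume "x \<in> S"
    moreover have "x \<in> cl x" unfolding cl_def sim_def using int_span_0 by force
    ultimately show "x \<in> \<Union> (cl ` S)" by blast
  next
    fix y assume "y \<in> \<Union> (cl ` S)"
    then show "y \<in> S" unfolding cl_def S using inv by blast
  qed
  ultimately show "\<exists>F. finite F \<and> (\<forall>T\<in>F. tmc_set (cyc \<alpha>) T) \<and> S = \<Union> F" by blast
qed

end
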